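(* Let $d,k\ge1$ be integers, let $\Sigma$ be a finite alphabet, and let $\Gamma\subseteq\mathcal{P}(\Sigma^{F_k^d})$ be a fully constrained system. Then $$h_{\mathrm{ind}}(\Gamma)=h_{\mathrm{ind}}^{\mathrm{com}}(\Gamma),$$ where $h_{\mathrm{ind}}$ is the (probabilistic) independence entropy and $h_{\mathrm{ind}}^{\mathrm{com}}$ is the combinatorial independence entropy.
   Context: Notation: $[n]=\{0,1,\dots,n-1\}$; $F_n^d=[n]^d\subset\mathbb{Z}^d$. $\mathcal{P}(X)$ is the set of probability measures on $X$; $\|\mu-\nu\|_{TV}=\sup_W|\mu(W)-\nu(W)|$. A set $\Gamma\subseteq\mathcal{P}(\Sigma^{F_k^d})$ is fully constrained if there is $L\subseteq\Sigma^{F_k^d}$ with $\Gamma=\{\mu\in\mathcal{P}(\Sigma^{F_k^d}):\mu(L)=1\}$. For $\epsilon>0$, $\mathbb{B}_\epsilon(\Gamma)=\{\mu\in\mathcal{P}(\Sigma^{F_k^d}): \inf_{\nu\in\Gamma}\|\mu-\nu\|_{TV}\le\epsilon\}$. Independence entropy: let $S=F_k^d$. For $n\ge k$ and $\mu\in\mathcal{P}(\Sigma^{F_n^d})$ let $\overline{\pi}_S(\mu)=\frac1{n^d}\sum_{\mathbf v\in F_n^d}\pi_{S+\mathbf v}(\mu)$, where $\pi_{S+\mathbf v}(\mu)$ is the marginal on $S+\mathbf v$ (coordinates taken modulo $n$), identified with a measure on $\Sigma^S$. Let $\overline{\mathcal{P}}_n(\Gamma)$ be the set of product measures $\mu=\prod_{\mathbf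 v\in F_n^d}p_{\mathbf v}$, $p_{\mathbf v}\in\mathcal{P}(\Sigma)$, on $\Sigma^{F_n^d}$ with $\overline{\pi}_S(\mu)\in\Gamma$. With $H(\mu)=-\sum_w\mu(w)\log_2\mu(w)$, set $\widehat{h_{\mathrm{ind}}}(\Gamma)=\limsup_{n\to\infty}\sup_{\mu\in\overline{\mathcal{P}}_n(\Gamma)}\frac1{n^d}H(\mu)$ and $h_{\mathrm{ind}}(\Gamma)=\lim_{\epsilon\to0^+}\widehat{h_{\mathrm{ind}}}(\mathbb{B}_\epsilon(\Gamma))$. Combinatorial independence entropy: for a fully constrained $\Gamma$, let $L\subseteq\Sigma^{F_k^d}$ be the set with $\Gamma=\{\mu\in\mathcal{P}(\Sigma^{F_k^d}):\mu(L)=1\}$ (it is determined by $\Gamma$), let $\Phi=\Sigma^{F_k^d}\setminus L$ be the set of forbidden patterns and $X_\Phi=\{x\in\Sigma^{\mathbb{Z}^d}:\forall\mathbf v\in\mathbb{Z}^d,\ x_{\mathbf v+F_k^d}\notin\Phi\}$ (patterns on $\mathbf v+F_k^d$ being identified with patterns on $F_k^d$ by translation). Let $\tilde\Sigma$ be the set of non-empty subsets of $\Sigma$. For $T\subseteq\mathbb{Z}^d$ and $\tilde x\in\tilde\Sigma^T$ let $\varphi(\tilde x)=\{x\in\Sigma^T:\forall\mathbf v\in T,\ x_{\mathbf v}\in\tilde x_{\mathbf v}\}$ be its set of fillings. For a shift space $X\subseteq\Sigma^{\mathbb{Z}^d}$ let $\tilde X=\{\tilde x\in\tilde\Sigma^{\mathbb{Z}^d}:\varphi(\tilde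 x)\subseteq X\}$ and $\mathcal{B}_n(\tilde X)=\{\tilde x_{F_n^d}:\tilde x\in\tilde X\}$ (restrictions to $F_n^d$). Define $h_{\mathrm{ind}}^{\mathrm{com}}(X)=\limsup_{n\to\infty}\frac1{n^d}\max\{\log_2|\varphi(\tilde w)|:\tilde w\in\mathcal{B}_n(\tilde X)\}$ and $h_{\mathrm{ind}}^{\mathrm{com}}(\Gamma)=h_{\mathrm{ind}}^{\mathrm{com}}(X_\Phi)$. Conventions: a supremum or maximum over the empty set is $-\infty$. *)

theory Defs
  imports "HOL-Probability.Probability"
begin

text \<open>
  The dimension is \<open>d = CARD('d)\<close>, so that the lattice is \<^typ>\<open>int ^ 'd\<close>, and the alphabet is the
  finite type \<^typ>\<open>'a\<close>. An element of \<open>\<Sigma>\<^sup>T\<close> is a function on the lattice which is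
  \<^const>\<open>undefined\<close> outside \<open>T\<close>. All spaces \<open>\<Sigma>\<^sup>T\<close> that carry measures are finite, so probability
  measures on them are given by \<^type>\<open>pmf\<close>s. Entropies are extended reals, where a supremum over the
  empty set is \<open>-\<infinity>\<close> and an infimum over the empty set is \<open>\<infinity>\<close>.
\<close>

definition cube :: "nat \<Rightarrow> (int ^ 'd::finite) set" where
  "cube n = {v. \<forall>i. 0 \<le> v $ i \<and> v $ i < int n}"

definition patterns :: "(int ^ 'd::finite) set \<Rightarrow> (int ^ 'd \<Rightarrow> 'a::finite) set" where
  "patterns T = (T \<rightarrow>\<^sub>E UNIV)"

definition prob_measures :: "'b set \<Rightarrow> 'b pmf set" where
  "prob_measures X = {\<mu>. set_pmf \<mu> \<subseteq> X}"

definition tv_dist :: "'b pmf \<Rightarrow> 'b pmf \<Rightarrow> real" where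
  "tv_dist \<mu> \<nu> = (SUP W. \<bar>measure_pmf.prob \<mu> W - measure_pmf.prob \<nu> W\<bar>)"

definition constrained_by ::
    "nat \<Rightarrow> (int ^ 'd::finite \<Rightarrow> 'a::finite) set \<Rightarrow> (int ^ 'd \<Rightarrow> 'a) pmf set" where
  "constrained_by k L = {\<mu> \<in> prob_measures (patterns (cube k)). measure_pmf.prob \<mu> L = 1}"

definition fully_constrained :: "nat \<Rightarrow> (int ^ 'd::finite \<Rightarrow> 'a::finite) pmf set \<Rightarrow> bool" where
  "fully_constrained k \<Gamma> \<longleftrightarrow> (\<exists>L \<subseteq> patterns (cube k). \<Gamma> = constrained_by k L)"

definition tv_neighbourhood ::
    "nat \<Rightarrow> real \<Rightarrow> (int ^ 'd::finite \<Rightarrow> 'a::finite) pmf set \<Rightarrow> (int ^ 'd \<Rightarrow> 'a) pmf set" where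
  "tv_neighbourhood k \<epsilon> \<Gamma> =
    {\<mu> \<in> prob_measures (patterns (cube k)). (INF \<nu>\<in>\<Gamma>. ereal (tv_dist \<mu> \<nu>)) \<le> ereal \<epsilon>}"


subsection \<open>Independence entropy\<close>

definition marginal ::
    "nat \<Rightarrow> nat \<Rightarrow> int ^ 'd::finite \<Rightarrow> (int ^ 'd \<Rightarrow> 'a::finite) pmf \<Rightarrow> (int ^ 'd \<Rightarrow> 'a) pmf" where
  "marginal k n v \<mu> = map_pmf (\<lambda>w. \<lambda>u\<in>cube k. w (\<chi> i. (u $ i + v $ i) mod int n)) \<mu>"

text \<open>The average over \<open>v\<close> is expressed as a uniform mixture; see \<open>pmf_avg_marginal\<close> below.\<close>

definition avg_marginal ::
    "nat \<Rightarrow> nat \<Rightarrow> (int ^ 'd::finite \<Rightarrow> 'a::finite) pmf \<Rightarrow> (int ^ 'd \<Rightarrow> 'a) pmf" where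
  "avg_marginal k n \<mu> = bind_pmf (pmf_of_set (cube n)) (\<lambda>v. marginal k n v \<mu>)"

definition product_measures ::
    "nat \<Rightarrow> nat \<Rightarrow> (int ^ 'd::finite \<Rightarrow> 'a::finite) pmf set \<Rightarrow> (int ^ 'd \<Rightarrow> 'a) pmf set" where
  "product_measures k n \<Gamma> =
    {\<mu>. (\<exists>p :: int ^ 'd \<Rightarrow> 'a pmf. \<mu> = Pi_pmf (cube n) undefined p) \<and> avg_marginal k n \<mu> \<in> \<Gamma>}"

text \<open>Atoms of measure 0 are omitted, following the convention \<open>0 log 0 = 0\<close>.\<close>

definition shannon_entropy :: "'b pmf \<Rightarrow> real" where
  "shannon_entropy \<mu> = - (\<Sum>w\<in>set_pmf \<mu>. pmf \<mu> w * log 2 (pmf \<mu> w))"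

text \<open>The terms with \<open>n < k\<close>, where the marginals wrap around the torus more than once, do not affect
  the limit superior.\<close>

definition h_ind_hat :: "nat \<Rightarrow> (int ^ 'd::finite \<Rightarrow> 'a::finite) pmf set \<Rightarrow> ereal" where
  "h_ind_hat k \<Gamma> =
    limsup (\<lambda>n. SUP \<mu>\<in>product_measures k n \<Gamma>. ereal (shannon_entropy \<mu> / real n ^ CARD('d)))"

text \<open>The limit always exists; see \<open>tendsto_h_ind\<close> below.\<close>

definition h_ind :: "nat \<Rightarrow> (int ^ 'd::finite \<Rightarrow> 'a::finite) pmf set \<Rightarrow> ereal" where
  "h_ind k \<Gamma> = Lim (at_right 0) (\<lambda>\<epsilon>. h_ind_hat k (tv_neighbourhood k \<epsilon> \<Gamma>))"


subsection \<open>Combinatorial independence entropy\<close>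

definition allowed_patterns ::
    "nat \<Rightarrow> (int ^ 'd::finite \<Rightarrow> 'a::finite) pmf set \<Rightarrow> (int ^ 'd \<Rightarrow> 'a) set" where
  "allowed_patterns k \<Gamma> = (THE L. L \<subseteq> patterns (cube k) \<and> \<Gamma> = constrained_by k L)"

definition forbidden_patterns ::
    "nat \<Rightarrow> (int ^ 'd::finite \<Rightarrow> 'a::finite) pmf set \<Rightarrow> (int ^ 'd \<Rightarrow> 'a) set" where
  "forbidden_patterns k \<Gamma> = patterns (cube k) - allowed_patterns k \<Gamma>"

definition shift_avoiding ::
    "nat \<Rightarrow> (int ^ 'd::finite \<Rightarrow> 'a::finite) set \<Rightarrow> (int ^ 'd \<Rightarrow> 'a) set" where
  "shift_avoiding k \<Phi> = {x. \<forall>v. (\<lambda>u\<in>cube k. x (v + u)) \<notin> \<Phi>}"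

definition set_patterns :: "(int ^ 'd::finite) set \<Rightarrow> (int ^ 'd \<Rightarrow> 'a::finite set) set" where
  "set_patterns T = (T \<rightarrow>\<^sub>E {A. A \<noteq> {}})"

definition fillings ::
    "(int ^ 'd::finite) set \<Rightarrow> (int ^ 'd \<Rightarrow> 'a::finite set) \<Rightarrow> (int ^ 'd \<Rightarrow> 'a) set" where
  "fillings T y = {x \<in> patterns T. \<forall>v\<in>T. x v \<in> y v}"

definition set_shift ::
    "(int ^ 'd::finite \<Rightarrow> 'a::finite) set \<Rightarrow> (int ^ 'd \<Rightarrow> 'a set) set" where
  "set_shift X = {y \<in> set_patterns UNIV. fillings UNIV y \<subseteq> X}"

definition set_blocks ::
    "nat \<Rightarrow> (int ^ 'd::finite \<Rightarrow> 'a::finite) set \<Rightarrow> (int ^ 'd \<Rightarrow> 'a set) set" where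
  "set_blocks n X = (\<lambda>y. restrict y (cube n)) ` set_shift X"

definition h_ind_com_shift :: "(int ^ 'd::finite \<Rightarrow> 'a::finite) set \<Rightarrow> ereal" where
  "h_ind_com_shift X =
    limsup (\<lambda>n. ereal (1 / real n ^ CARD('d)) *
      (SUP w\<in>set_blocks n X. ereal (log 2 (real (card (fillings (cube n) w))))))"

definition h_ind_com :: "nat \<Rightarrow> (int ^ 'd::finite \<Rightarrow> 'a::finite) pmf set \<Rightarrow> ereal" where
  "h_ind_com k \<Gamma> = h_ind_com_shift (shift_avoiding k (forbidden_patterns k \<Gamma>))"


subsection \<open>Well-definedness\<close>

lemma bij_betw_cube:
  "bij_betw (\<lambda>f. \<chi> i. f i) (UNIV \<rightarrow>\<^sub>E {0..<int n}) (cube n :: (int ^ 'd::finite) set)"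
  by (rule bij_betwI[where g = "\<lambda>v i. v $ i"]) (auto simp: cube_def PiE_def Pi_def extensional_def)

lemma finite_cube: "finite (cube n :: (int ^ 'd::finite) set)"
  using bij_betw_finite[OF bij_betw_cube[of n, where 'd = 'd]] by (auto intro!: finite_PiE)

lemma card_cube: "card (cube n :: (int ^ 'd::finite) set) = n ^ CARD('d)"
  using bij_betw_same_card[OF bij_betw_cube[of n, where 'd = 'd]] by (simp add: card_PiE)

lemma pmf_avg_marginal:
  fixes \<mu> :: "(int ^ 'd::finite \<Rightarrow> 'a::finite) pmf"
  assumes "n > 0"
  shows "pmf (avg_marginal k n \<mu>) w = (\<Sum>v\<in>cube n. pmf (marginal k n v \<mu>) w) / real n ^ CARD('d)"
proof -
  have "(cube n :: (int ^ 'd) set) \<noteq> {}"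
    using card_cube[of n, where 'd = 'd] assms by fastforce
  then show ?thesis
    by (simp add: avg_marginal_def pmf_bind_pmf_of_set finite_cube card_cube)
qed

lemma constrained_by_inject:
  assumes "L \<subseteq> patterns (cube k)" "L' \<subseteq> patterns (cube k)" "constrained_by k L = constrained_by k L'"
  shows "L = L'"
proof -
  have "w \<in> M \<longleftrightarrow> return_pmf w \<in> constrained_by k M" if "w \<in> patterns (cube k)" for w M
    using that by (auto simp: constrained_by_def prob_measures_def indicator_def)
  with assms show ?thesis
    by blast
qed

lemma allowed_patterns_constrained_by:
  "L \<subseteq> patterns (cube k) \<Longrightarrow> allowed_patterns k (constrained_by k L) = L"
  unfolding allowed_patterns_def by (rule the_equality) (auto dest: constrained_by_inject)

lemma h_ind_hat_mono:
  assumes "\<Gamma> \<subseteq> \<Gamma>'"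
  shows "h_ind_hat k \<Gamma> \<le> h_ind_hat k \<Gamma>'"
  unfolding h_ind_hat_def
  by (intro Limsup_mono always_eventually allI SUP_subset_mono)
     (use assms in \<open>auto simp: product_measures_def\<close>)

lemma tendsto_h_ind:
  "((\<lambda>\<epsilon>. h_ind_hat k (tv_neighbourhood k \<epsilon> \<Gamma>)) \<longlongrightarrow> h_ind k \<Gamma>) (at_right 0)"
proof -
  define f where "f = (\<lambda>\<epsilon>. h_ind_hat k (tv_neighbourhood k \<epsilon> \<Gamma>))"
  have mono: "f x \<le> f y" if "x \<le> y" for x y
    unfolding f_def using that
    by (intro h_ind_hat_mono) (auto simp: tv_neighbourhood_def intro: order_trans)
  have "(f \<longlongrightarrow> (INF \<epsilon>\<in>{0<..}. f \<epsilon>)) (at_right 0)"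
  proof (rule order_tendstoI)
    fix a assume a: "a < (INF \<epsilon>\<in>{0<..}. f \<epsilon>)"
    show "eventually (\<lambda>x. a < f x) (at_right 0)"
      using eventually_at_right_less[of 0]
      by eventually_elim (use a in \<open>auto intro: less_le_trans INF_lower\<close>)
  next
    fix a assume "(INF \<epsilon>\<in>{0<..}. f \<epsilon>) < a"
    then obtain e where "e > 0" "f e < a"
      by (auto simp: INF_less_iff)
    then show "eventually (\<lambda>x. f x < a) (at_right 0)"
      unfolding eventually_at_right[OF \<open>e > 0\<close>]
      by (meson mono less_imp_le le_less_trans)
  qed
  then show ?thesis
    unfolding h_ind_def f_def[symmetric] by (metis tendsto_Lim trivial_limit_at_right_real)
qed

end

theory Submission
  imports Defs "HOL-Library.Diagonal_Subsequence" "HOL-Real_Asymp.Real_Asymp"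
begin

text \<open>
  Let \<open>L\<close> be the set of patterns that \<open>\<Gamma>\<close> allows. A measure on patterns is close to \<open>\<Gamma>\<close> in total variation
  exactly if it gives little mass to the complement of \<open>L\<close> (\<open>prob_le_of_tv_neighbourhood\<close> and
  \<open>tv_neighbourhoodI\<close>). So \<open>h_ind\<close> concerns product measures on a torus for which a typical window rarely
  shows a forbidden pattern, and \<open>h_ind_com\<close> concerns choices of a set of symbols at each site for which no
  filling ever shows one.

  From sets to measures: the uniform measure on the fillings of a block of side \<open>n\<close> is a product measure.
  Its entropy is the logarithm of the number of fillings, and forbidden patterns can appear only in the
  windows that wrap around the torus, a fraction that tends to 0. This gives \<open>h_ind_com \<le> h_ind\<close>
  (\<open>h_ind_com_shift_le_h_ind_hat\<close>).

  From measures to sets: replace the distribution at each site by the set of symbols of mass at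
  least \<open>\<delta>\<close>. This costs entropy that vanishes with \<open>\<delta>\<close> (\<open>shannon_entropy_le_log_card_large\<close>). By independence
  every filling of a window has mass at least \<open>\<delta> ^ (k ^ d)\<close>, so a window whose forbidden mass is smaller than
  that has no forbidden filling at all (\<open>admissible_at_large_atoms\<close>). By Markov's inequality most windows
  are of this kind. It remains to pass from blocks that look correct locally to blocks that extend to
  the whole lattice. A compactness argument provides a finite set of window positions that suffices for
  this (\<open>locally_admissible_imp_extendable\<close>). Averaging the entropy of a block of side \<open>r\<close> over all its
  translates on the torus then bounds \<open>h_ind\<close> by the largest \<open>log 2 |\<phi>(w)| / r ^ d\<close> over blocks \<open>w\<close> of side \<open>r\<close>,
  for every single \<open>r\<close> (\<open>h_ind_le_block_rate\<close>), and hence by \<open>h_ind_com\<close>.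
\<close>

section \<open>Translations of the torus\<close>

definition torus_mod :: "nat \<Rightarrow> int ^ 'd::finite \<Rightarrow> int ^ 'd" where
  "torus_mod n v = (\<chi> i. v $ i mod int n)"

lemma torus_mod_in_cube: "n > 0 \<Longrightarrow> torus_mod n v \<in> cube n"
  by (simp add: torus_mod_def cube_def)

lemma torus_mod_cube: "v \<in> cube n \<Longrightarrow> torus_mod n v = v"
  by (simp add: torus_mod_def cube_def vec_eq_iff)

lemma torus_mod_add_left: "torus_mod n (torus_mod n v + u) = torus_mod n (v + u)"
  by (simp add: torus_mod_def vec_eq_iff mod_simps)

text \<open>
  On a torus of side at least \<open>k\<close> a window of side \<open>k\<close> does not meet itself, so the coordinates of a
  product measure that it sees are independent.
\<close>

lemma inj_on_torus_mod_translate: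
  fixes c :: "int ^ 'd::finite"
  assumes "k \<le> n"
  shows "inj_on (\<lambda>u. torus_mod n (c + u)) (cube k)"
proof (rule inj_onI)
  fix u v :: "int ^ 'd"
  assume uv: "u \<in> cube k" "v \<in> cube k" and eq: "torus_mod n (c + u) = torus_mod n (c + v)"
  show "u = v"
  proof (unfold vec_eq_iff, intro allI)
    fix i
    have "(c $ i + u $ i) mod int n = (c $ i + v $ i) mod int n"
      using eq by (auto simp: torus_mod_def vec_eq_iff)
    then have "u $ i mod int n = v $ i mod int n"
      by (metis add_diff_cancel_left' mod_diff_left_eq mod_diff_eq)
    moreover have "0 \<le> u $ i \<and> u $ i < int n" "0 \<le> v $ i \<and> v $ i < int n"
      using uv assms by (auto simp: cube_def intro: less_le_trans)
    ultimately show "u $ i = v $ i"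
      by simp
  qed
qed

text \<open>
  Averages over the torus are translation invariant. Because of this the torus can be covered by all
  translates of a block at once, and no boundary terms appear in the upper bound.
\<close>

lemma sum_torus_translate:
  fixes f :: "int ^ 'd::finite \<Rightarrow> 'b::comm_monoid_add"
  assumes "n > 0" and periodic: "\<And>v. f (torus_mod n v) = f v"
  shows "(\<Sum>v\<in>cube n. f (v + u)) = (\<Sum>v\<in>cube n. f v)"
proof (rule sum.reindex_bij_witness[where i = "\<lambda>v. torus_mod n (v - u)" and j = "\<lambda>v. torus_mod n (v + u)"])
  fix v :: "int ^ 'd" assume v: "v \<in> cube n"
  show "torus_mod n (torus_mod n (v + u) - u) = v"
    using torus_mod_add_left[of n "v + u" "- u"] torus_mod_cube[OF v] by simp
  show "torus_mod n (torus_mod n (v - u) + u) = v"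
    using torus_mod_add_left[of n "v - u" "u"] torus_mod_cube[OF v] by simp
qed (use assms in \<open>auto intro: torus_mod_in_cube\<close>)

section \<open>Set-valued configurations and compactness\<close>

definition window :: "nat \<Rightarrow> (int ^ 'd::finite \<Rightarrow> 'a) \<Rightarrow> int ^ 'd \<Rightarrow> (int ^ 'd \<Rightarrow> 'a)" where
  "window k x c = (\<lambda>u\<in>cube k. x (c + u))"

text \<open>
  Every filling of \<open>y\<close> shows a pattern of \<open>L\<close> in the window at \<open>c\<close>. Fillings of the whole lattice are used
  so that windows at different positions can be compared without restricting \<open>y\<close>.
\<close>

definition admissible_at ::
    "nat \<Rightarrow> (int ^ 'd::finite \<Rightarrow> 'a) set \<Rightarrow> (int ^ 'd \<Rightarrow> 'a set) \<Rightarrow> int ^ 'd \<Rightarrow> bool" where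
  "admissible_at k L y c \<longleftrightarrow> (\<forall>x. (\<forall>v. x v \<in> y v) \<longrightarrow> window k x c \<in> L)"

lemma window_in_patterns: "window k x c \<in> patterns (cube k)"
  by (simp add: window_def patterns_def)

text \<open>
  The requirement that all fillings avoid the forbidden patterns can be checked window by window. This
  is what makes membership in the set-valued shift a condition on finite pieces.
\<close>

lemma set_shift_avoiding_iff:
  "y \<in> set_shift (shift_avoiding k (patterns (cube k) - L)) \<longleftrightarrow>
     (\<forall>v. y v \<noteq> {}) \<and> (\<forall>c. admissible_at k L y c)"
  using window_in_patterns[of k]
  by (auto simp: set_shift_def set_patterns_def shift_avoiding_def fillings_def admissible_at_def
      patterns_def window_def PiE_UNIV_domain)

text \<open>
  A filling of \<open>y'\<close> can be changed outside the window to a filling of \<open>y\<close>, provided that \<open>y\<close> offers a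
  symbol everywhere; so only the values of \<open>y\<close> on the window count.
\<close>

lemma admissible_at_cong:
  assumes ne: "\<And>v. y v \<noteq> {}" and adm: "admissible_at k L y c"
    and eq: "\<And>u. u \<in> cube k \<Longrightarrow> y' (c + u) = y (c + u)"
  shows "admissible_at k L y' c"
  unfolding admissible_at_def
proof (intro allI impI)
  fix x assume x: "\<forall>v. x v \<in> y' v"
  define x' where "x' = (\<lambda>v. if v - c \<in> cube k then x v else (SOME a. a \<in> y v))"
  have "x' v \<in> y v" for v
    using x eq[of "v - c"] ne[of v] by (auto simp: x'_def some_in_eq)
  then have "window k x' c \<in> L"
    using adm by (auto simp: admissible_at_def)
  also have "window k x' c = window k x c"
    by (auto simp: window_def x'_def fun_eq_iff restrict_def)
  finally show "window k x c \<in> L" .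
qed

text \<open>
  Sequential compactness of \<open>B\<^sup>I\<close> for a finite set \<open>B\<close> and a countable set \<open>I\<close>: at each index some value recurs
  infinitely often, and a diagonal subsequence stabilises at every index.
\<close>

lemma pointwise_stabilising_subsequence:
  fixes y :: "nat \<Rightarrow> 'i::countable \<Rightarrow> 'b::finite"
  shows "\<exists>r z. strict_mono (r :: nat \<Rightarrow> nat) \<and> (\<forall>v. \<forall>\<^sub>F i in sequentially. y (r i) v = z v)"
proof -
  define P where "P = (\<lambda>n (s :: nat \<Rightarrow> nat). \<exists>b. \<forall>i. y (s i) (from_nat n) = b)"
  interpret subseqs P
  proof
    fix n and s :: "nat \<Rightarrow> nat"
    obtain i0 where inf: "infinite {i. y (s i) (from_nat n) = y (s i0) (from_nat n)}"
      using pigeonhole_infinite[of "UNIV :: nat set" "\<lambda>i. y (s i) (from_nat n)"] by auto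
    obtain r :: "nat \<Rightarrow> nat" where "strict_mono r" "\<And>i. r i \<in> {i. y (s i) (from_nat n) = y (s i0) (from_nat n)}"
      using infinite_enumerate[OF inf] by auto
    then show "\<exists>r'. strict_mono r' \<and> P n (s \<circ> r')"
      by (auto simp: P_def)
  qed
  have "P n (diagseq \<circ> ((+) (Suc n)))" for n
    by (rule diagseq_holds) (auto simp: P_def)
  then obtain b where b: "\<And>n i. y (diagseq (Suc n + i)) (from_nat n) = b n"
    unfolding P_def o_def by metis
  have "\<forall>\<^sub>F i in sequentially. y (diagseq i) v = b (to_nat v)" for v
    unfolding eventually_sequentially
  proof (intro exI allI impI)
    fix i assume "Suc (to_nat v) \<le> i"
    then show "y (diagseq i) v = b (to_nat v)"
      using b[of "to_nat v" "i - Suc (to_nat v)"] by simp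
  qed
  then show ?thesis
    using subseq_diagseq by (intro exI[of _ diagseq] exI[of _ "\<lambda>v. b (to_nat v)"]) auto
qed

text \<open>
  Local admissibility on a large enough finite region forces the block at the origin to occur in
  the set-valued shift. Otherwise there would be configurations that are admissible on larger and larger
  regions and whose blocks at the origin do not occur; a pointwise limit of them lies in the set-valued shift
  and agrees with one of them on this block. The region depends only on \<open>k\<close>, \<open>L\<close> and \<open>r\<close>, which lets
  it be fixed before the size of the torus and the tolerance are chosen.
\<close>

lemma locally_admissible_imp_extendable:
  fixes L :: "(int ^ 'd::finite \<Rightarrow> 'a::finite) set"
  obtains F where "finite F"
    and "\<And>y. \<lbrakk>\<And>v. y v \<noteq> {}; \<And>c. c \<in> F \<Longrightarrow> admissible_at k L y c\<rbrakk> \<Longrightarrow>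
      restrict y (cube r) \<in> set_blocks r (shift_avoiding k (patterns (cube k) - L))"
proof (rule ccontr)
  let ?X = "shift_avoiding k (patterns (cube k) - L)"
  \<comment> \<open>The regions exhaust the lattice along an enumeration of it.\<close>
  define F where "F m = (from_nat :: nat \<Rightarrow> int ^ 'd) ` {..m}" for m
  assume contr: "\<not> thesis"
  have fin: "finite (F m)" for m
    by (simp add: F_def)
  have "\<exists>y. (\<forall>v. y v \<noteq> {}) \<and> (\<forall>c\<in>F m. admissible_at k L y c) \<and>
       restrict y (cube r) \<notin> set_blocks r ?X" for m
  proof (rule ccontr)
    assume "\<not> ?thesis"
    then have "thesis"
      by (intro that[OF fin[of m]]) blast
    with contr show False ..
  qed
  then obtain y where ne: "\<And>m v. y m v \<noteq> {}"
    and adm: "\<And>m c. c \<in> F m \<Longrightarrow> admissible_at k L (y m) c"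
    and bad: "\<And>m. restrict (y m) (cube r) \<notin> set_blocks r ?X"
    by metis
  obtain s :: "nat \<Rightarrow> nat" and z where s: "strict_mono s"
    and z: "\<And>v. \<forall>\<^sub>F i in sequentially. y (s i) v = z v"
    using pointwise_stabilising_subsequence[of y] by auto
  have agree: "\<forall>\<^sub>F i in sequentially. \<forall>u\<in>cube m. y (s i) (c + u) = z (c + u)" for m c
    using z by (intro eventually_ball_finite) (auto simp: finite_cube)
  have "z v \<noteq> {}" for v
    using eventually_happens[OF z[of v]] ne by auto
  moreover have "admissible_at k L z c" for c
  proof -
    have "\<forall>\<^sub>F i in sequentially. c \<in> F (s i)"
      unfolding eventually_sequentially
    proof (intro exI allI impI)
      fix i assume "to_nat c \<le> i"
      also have "i \<le> s i"
        using s by (rule seq_suble)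
      finally show "c \<in> F (s i)"
        unfolding F_def by (intro image_eqI[of _ _ "to_nat c"]) auto
    qed
    with agree[of k c] have "\<forall>\<^sub>F i in sequentially. c \<in> F (s i) \<and> (\<forall>u\<in>cube k. y (s i) (c + u) = z (c + u))"
      by eventually_elim auto
    from eventually_happens[OF this]
    obtain i where "c \<in> F (s i)" "\<And>u. u \<in> cube k \<Longrightarrow> z (c + u) = y (s i) (c + u)"
      by auto
    then show ?thesis
      by (intro admissible_at_cong[of "y (s i)" k L c z] ne adm)
  qed
  ultimately have "z \<in> set_shift ?X"
    by (simp add: set_shift_avoiding_iff)
  moreover obtain i where "\<And>u. u \<in> cube r \<Longrightarrow> y (s i) u = z u"
    using eventually_happens[OF agree[of r 0]] by auto
  then have "restrict (y (s i)) (cube r) = restrict z (cube r)"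
    by (rule restrict_ext)
  ultimately have "restrict (y (s i)) (cube r) \<in> set_blocks r ?X"
    by (auto simp: set_blocks_def)
  with bad show False
    by blast
qed

section \<open>Shannon entropy\<close>

lemma shannon_entropy_expectation:
  assumes "finite (set_pmf \<mu>)"
  shows "shannon_entropy \<mu> = - measure_pmf.expectation \<mu> (\<lambda>w. log 2 (pmf \<mu> w))"
  using assms by (simp add: shannon_entropy_def integral_measure_pmf_real[of "set_pmf \<mu>"] mult.commute)

text \<open>
  On the support the logarithm of a product density is a sum of functions of single coordinates, and the
  expectation of each of them depends only on the marginal at its coordinate.
\<close>

lemma shannon_entropy_Pi_pmf:
  fixes p :: "'i \<Rightarrow> 'a::finite pmf"
  assumes "finite A"
  shows "shannon_entropy (Pi_pmf A d p) = (\<Sum>v\<in>A. shannon_entropy (p v))"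
proof -
  let ?\<mu> = "Pi_pmf A d p"
  have supp: "set_pmf ?\<mu> = PiE_dflt A d (\<lambda>v. set_pmf (p v))"
    using assms by (simp add: set_Pi_pmf o_def)
  then have fin: "finite (set_pmf ?\<mu>)"
    using assms by (auto intro!: finite_PiE_dflt)
  have log_pmf: "log 2 (pmf ?\<mu> w) = (\<Sum>v\<in>A. log 2 (pmf (p v) (w v)))" if "w \<in> set_pmf ?\<mu>" for w
  proof -
    have "w v \<in> set_pmf (p v)" if "v \<in> A" for v
      using that \<open>w \<in> set_pmf ?\<mu>\<close> by (auto simp: supp PiE_dflt_def)
    moreover have "pmf ?\<mu> w = (\<Prod>v\<in>A. pmf (p v) (w v))"
      using that assms by (intro pmf_Pi') (auto simp: supp PiE_dflt_def)
    ultimately show ?thesis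
      using assms by (simp add: log_def sum_divide_distrib[symmetric] set_pmf_iff ln_prod)
  qed
  have "shannon_entropy ?\<mu> = - measure_pmf.expectation ?\<mu> (\<lambda>w. log 2 (pmf ?\<mu> w))"
    by (rule shannon_entropy_expectation[OF fin])
  also have "measure_pmf.expectation ?\<mu> (\<lambda>w. log 2 (pmf ?\<mu> w)) =
      measure_pmf.expectation ?\<mu> (\<lambda>w. \<Sum>v\<in>A. log 2 (pmf (p v) (w v)))"
    using log_pmf by (intro integral_cong_AE) (auto simp: AE_measure_pmf_iff)
  also have "\<dots> = (\<Sum>v\<in>A. measure_pmf.expectation ?\<mu> (\<lambda>w. log 2 (pmf (p v) (w v))))"
    by (intro Bochner_Integration.integral_sum integrable_measure_pmf_finite fin)
  also have "\<dots> = (\<Sum>v\<in>A. measure_pmf.expectation (map_pmf (\<lambda>w. w v) ?\<mu>) (\<lambda>a. log 2 (pmf (p v) a)))"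
    by simp
  also have "\<dots> = (\<Sum>v\<in>A. measure_pmf.expectation (p v) (\<lambda>a. log 2 (pmf (p v) a)))"
    using assms by (intro sum.cong refl) (simp add: Pi_pmf_component)
  finally show ?thesis
    by (simp add: shannon_entropy_expectation sum_negf)
qed

lemma shannon_entropy_alt:
  fixes p :: "'a::finite pmf"
  shows "shannon_entropy p = (\<Sum>a\<in>UNIV. - pmf p a * ln (pmf p a)) / ln 2"
proof -
  have "(\<Sum>a\<in>set_pmf p. pmf p a * log 2 (pmf p a)) = (\<Sum>a\<in>UNIV. pmf p a * log 2 (pmf p a))"
    by (intro sum.mono_neutral_left) (auto simp: set_pmf_iff)
  then show ?thesis
    by (simp add: shannon_entropy_def log_def sum_negf sum_divide_distrib)
qed

lemma shannon_entropy_pmf_of_set: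
  fixes S :: "'a::finite set"
  assumes "S \<noteq> {}"
  shows "shannon_entropy (pmf_of_set S) = log 2 (real (card S))"
proof -
  have "card S > 0"
    using assms by (simp add: card_gt_0_iff)
  then show ?thesis
    using assms by (simp add: shannon_entropy_def log_divide)
qed

text \<open>
  The inequality \<open>ln t \<le> t - 1\<close> at \<open>t = 1 / (p\<^sub>a |S|)\<close>, weighted by \<open>p\<^sub>a\<close> and summed over \<open>S\<close>. For \<open>S = UNIV\<close> it
  says that entropy is at most the logarithm of the number of symbols; the slack \<open>1 - s\<close> is small when
  \<open>S\<close> carries almost all of the mass.
\<close>

lemma gibbs_restricted:
  fixes p :: "'a::finite pmf"
  assumes "S \<noteq> {}"
  defines "s \<equiv> measure_pmf.prob p S"
  shows "(\<Sum>a\<in>S. - pmf p a * ln (pmf p a)) \<le> s * ln (real (card S)) + (1 - s)"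
proof -
  have c: "real (card S) > 0"
    using assms by (simp add: card_gt_0_iff)
  have "(\<Sum>a\<in>S. - pmf p a * ln (pmf p a)) \<le>
      (\<Sum>a\<in>S. pmf p a * ln (real (card S)) + (1 / real (card S) - pmf p a))"
  proof (rule sum_mono)
    fix a
    show "- pmf p a * ln (pmf p a) \<le> pmf p a * ln (real (card S)) + (1 / real (card S) - pmf p a)"
    proof (cases "pmf p a = 0")
      case False
      then have q: "pmf p a > 0"
        by (simp add: pmf_nonneg less_le)
      have "ln (1 / (pmf p a * real (card S))) \<le> 1 / (pmf p a * real (card S)) - 1"
        using q c by (intro ln_le_minus_one) auto
      then have "pmf p a * ln (1 / (pmf p a * real (card S))) \<le> pmf p a * (1 / (pmf p a * real (card S)) - 1)"
        using q by (intro mult_left_mono) auto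
      also have "pmf p a * (1 / (pmf p a * real (card S)) - 1) = 1 / real (card S) - pmf p a"
        using q c by (simp add: field_simps)
      also have "ln (1 / (pmf p a * real (card S))) = - ln (pmf p a) - ln (real (card S))"
        using q c assms(1) by (auto simp: ln_div ln_mult card_gt_0_iff)
      finally show ?thesis
        by (simp add: algebra_simps)
    qed simp
  qed
  also have "\<dots> = s * ln (real (card S)) + (1 - s)"
    using c assms(1) by (simp add: sum.distrib sum_subtractf s_def measure_measure_pmf_finite sum_distrib_right)
  finally show ?thesis .
qed

lemma shannon_entropy_le_log_card:
  fixes p :: "'a::finite pmf"
  shows "shannon_entropy p \<le> log 2 (real CARD('a))"
  using gibbs_restricted[of UNIV p]
  by (simp add: shannon_entropy_alt log_def divide_right_mono)

text \<open>
  Atoms of small mass contribute little entropy: write \<open>ln x = 2 ln (sqrt x)\<close> and use \<open>ln t \<le> t - 1\<close> at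
  \<open>t = 1 / sqrt x\<close>.
\<close>

lemma minus_x_ln_x_le_sqrt:
  fixes x :: real
  assumes "0 \<le> x"
  shows "- x * ln x \<le> 2 * sqrt x"
proof (cases "x = 0")
  case False
  then have x: "x > 0" "sqrt x > 0"
    using assms by auto
  have "- ln (sqrt x) \<le> 1 / sqrt x - 1"
    using ln_le_minus_one[of "1 / sqrt x"] x by (simp add: ln_div)
  then have "2 * x * (- ln (sqrt x)) \<le> 2 * x * (1 / sqrt x - 1)"
    using x by (intro mult_left_mono) auto
  also have "x * (1 / sqrt x) = sqrt x"
    using x real_div_sqrt[of x] by simp
  then have "2 * x * (1 / sqrt x - 1) = 2 * sqrt x - 2 * x"
    by (simp add: right_diff_distrib)
  also have "\<dots> \<le> 2 * sqrt x"
    using x by simp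
  finally show ?thesis
    using x by (simp add: ln_sqrt)
qed simp

text \<open>
  This passes from probabilities to combinatorics: up to an error that vanishes with \<open>\<delta>\<close>, the entropy
  of \<open>p\<close> is bounded by the logarithm of the number of symbols of mass at least \<open>\<delta>\<close>. Both the missing mass
  of the light symbols and their own entropy are at most of order \<open>sqrt \<delta>\<close>.
\<close>

lemma shannon_entropy_le_log_card_large:
  fixes p :: "'a::finite pmf"
  assumes \<delta>: "0 < \<delta>" "\<delta> * real CARD('a) \<le> 1"
  defines "S \<equiv> {a. \<delta> \<le> pmf p a}"
  shows "S \<noteq> {}"
    and "shannon_entropy p \<le> log 2 (real (card S)) + 3 * real CARD('a) * sqrt \<delta> / ln 2"
proof -
  let ?N = "real CARD('a)"
  have N: "?N \<ge> 1"
    by (simp add: Suc_leI)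
  then have "\<delta> \<le> 1"
    using \<delta> mult_left_mono[OF N, of \<delta>] by linarith
  then have sqrt_le: "\<delta> \<le> sqrt \<delta>"
    using \<delta> by (simp add: real_le_rsqrt power2_eq_square mult_left_le)
  show ne: "S \<noteq> {}"
  proof
    assume "S = {}"
    then have "pmf p a < \<delta>" for a
      by (auto simp: S_def not_le)
    then have "(\<Sum>a\<in>UNIV. pmf p a) < (\<Sum>a\<in>(UNIV :: 'a set). \<delta>)"
      by (intro sum_strict_mono) auto
    then show False
      using \<delta> sum_pmf_eq_1[of UNIV p] by (simp add: mult.commute)
  qed
  define s where "s = measure_pmf.prob p S"
  have compl: "1 - s = (\<Sum>a\<in>-S. pmf p a)"
    using measure_pmf.prob_compl[of S p]
    by (simp add: s_def Compl_eq_Diff_UNIV measure_measure_pmf_finite)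
  have card_compl: "real (card (- S)) \<le> ?N"
    by (simp add: card_mono)
  have "1 - s \<le> (\<Sum>a\<in>-S. \<delta>)"
    unfolding compl by (intro sum_mono) (auto simp: S_def)
  also have "\<dots> \<le> ?N * sqrt \<delta>"
    using card_compl sqrt_le \<delta> by (auto intro!: mult_mono)
  finally have s1: "1 - s \<le> ?N * sqrt \<delta>" .
  have "(\<Sum>a\<in>-S. - pmf p a * ln (pmf p a)) \<le> (\<Sum>a\<in>-S. 2 * sqrt \<delta>)"
  proof (intro sum_mono order.trans[OF minus_x_ln_x_le_sqrt])
    fix a assume "a \<in> - S"
    then show "2 * sqrt (pmf p a) \<le> 2 * sqrt \<delta>"
      by (auto simp: S_def)
  qed auto
  also have "\<dots> \<le> 2 * ?N * sqrt \<delta>"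
    using card_compl \<delta> by (simp add: mult_right_mono)
  finally have s2: "(\<Sum>a\<in>-S. - pmf p a * ln (pmf p a)) \<le> 2 * ?N * sqrt \<delta>" .
  have "card S \<ge> 1"
    using ne by (simp add: Suc_leI card_gt_0_iff)
  then have "s * ln (real (card S)) \<le> ln (real (card S))"
    by (intro mult_left_le_one_le) (auto simp: s_def)
  then have "(\<Sum>a\<in>S. - pmf p a * ln (pmf p a)) \<le> ln (real (card S)) + ?N * sqrt \<delta>"
    using gibbs_restricted[OF ne, of p] s1 unfolding s_def by linarith
  moreover have "(\<Sum>a\<in>UNIV. - pmf p a * ln (pmf p a)) =
      (\<Sum>a\<in>S. - pmf p a * ln (pmf p a)) + (\<Sum>a\<in>-S. - pmf p a * ln (pmf p a))"
    using sum.union_disjoint[of S "- S" "\<lambda>a. - pmf p a * ln (pmf p a)"] by (simp add: Compl_partition)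
  ultimately have "(\<Sum>a\<in>UNIV. - pmf p a * ln (pmf p a)) \<le> ln (real (card S)) + 3 * ?N * sqrt \<delta>"
    using s2 by linarith
  then have "(\<Sum>a\<in>UNIV. - pmf p a * ln (pmf p a)) / ln 2 \<le> (ln (real (card S)) + 3 * ?N * sqrt \<delta>) / ln 2"
    by (intro divide_right_mono) auto
  then show "shannon_entropy p \<le> log 2 (real (card S)) + 3 * ?N * sqrt \<delta> / ln 2"
    by (simp add: shannon_entropy_alt log_def add_divide_distrib)
qed

section \<open>Marginals of product measures\<close>

text \<open>
  Stated for events rather than points, since the event of interest is the complement of \<open>L\<close>.
\<close>

lemma prob_avg_marginal:
  fixes \<mu> :: "(int ^ 'd::finite \<Rightarrow> 'a::finite) pmf"
  assumes "n > 0"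
  shows "measure_pmf.prob (avg_marginal k n \<mu>) W =
    (\<Sum>v\<in>cube n. measure_pmf.prob (marginal k n v \<mu>) W) / real n ^ CARD('d)"
proof -
  let ?P = "patterns (cube k) :: (int ^ 'd \<Rightarrow> 'a) set"
  \<comment> \<open>The measures live on the finite set of patterns, so events reduce to finite sums of point masses.\<close>
  have fin: "finite (W \<inter> ?P)"
    by (auto simp: patterns_def finite_cube intro!: finite_PiE)
  have marg: "set_pmf (marginal k n v \<mu>) \<subseteq> ?P" for v
    by (auto simp: marginal_def patterns_def)
  then have avg: "set_pmf (avg_marginal k n \<mu>) \<subseteq> ?P"
    by (auto simp: avg_marginal_def)
  have restr: "measure_pmf.prob \<nu> W = (\<Sum>w\<in>W \<inter> ?P. pmf \<nu> w)" if "set_pmf \<nu> \<subseteq> ?P" for \<nu>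
  proof -
    have "measure_pmf.prob \<nu> W = measure_pmf.prob \<nu> (W \<inter> ?P)"
      using that by (intro measure_pmf.finite_measure_eq_AE) (auto simp: AE_measure_pmf_iff)
    then show ?thesis
      by (simp add: measure_measure_pmf_finite[OF fin])
  qed
  show ?thesis
    unfolding restr[OF marg] restr[OF avg] pmf_avg_marginal[OF assms]
    by (subst sum.swap) (simp flip: sum_divide_distrib)
qed

lemma marginal_alt: "marginal k n v \<mu> = map_pmf (\<lambda>w. \<lambda>u\<in>cube k. w (torus_mod n (v + u))) \<mu>"
  by (simp add: marginal_def torus_mod_def add.commute)

lemma marginal_torus_mod: "marginal k n (torus_mod n v) \<mu> = marginal k n v \<mu>"
  by (simp add: marginal_alt torus_mod_add_left)

text \<open>
  The event that the window at \<open>c\<close> looks like \<open>x\<close> is a cylinder. Since distinct sites of the window are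
  distinct sites of the torus, it prescribes one symbol at each site of the torus that the window meets.
\<close>

lemma pmf_marginal_Pi_pmf:
  fixes p :: "int ^ 'd::finite \<Rightarrow> 'a::finite pmf"
  assumes "k \<le> n" "n > 0"
  shows "pmf (marginal k n c (Pi_pmf (cube n) undefined p)) (window k x c) =
    (\<Prod>u\<in>cube k. pmf (p (torus_mod n (c + u))) (x (c + u)))"
proof -
  let ?\<tau> = "\<lambda>u. torus_mod n (c + u)"
  let ?\<mu> = "Pi_pmf (cube n) undefined p"
  \<comment> \<open>The symbols that site \<open>v\<close> of the torus may carry: one symbol if the window meets \<open>v\<close>, any symbol otherwise.\<close>
  define C where "C v = {a. \<forall>u\<in>cube k. ?\<tau> u = v \<longrightarrow> a = x (c + u)}" for v
  have inj: "inj_on ?\<tau> (cube k)"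
    using assms by (intro inj_on_torus_mod_translate)
  have C_\<tau>: "C (?\<tau> u) = {x (c + u)}" if "u \<in> cube k" for u
    using that inj by (auto simp: C_def inj_on_def)
  have C_UNIV: "C v = UNIV" if "v \<notin> ?\<tau> ` cube k" for v
    using that by (auto simp: C_def)
  have sub: "?\<tau> ` cube k \<subseteq> cube n"
    using assms by (auto intro: torus_mod_in_cube)
  have "pmf (marginal k n c ?\<mu>) (window k x c) =
      measure_pmf.prob ?\<mu> ((\<lambda>w. \<lambda>u\<in>cube k. w (?\<tau> u)) -` {window k x c})"
    by (simp add: marginal_alt pmf_map)
  also have "(\<lambda>w. \<lambda>u\<in>cube k. w (?\<tau> u)) -` {window k x c} = Pi (cube n) C"
  proof (intro equalityI subsetI)
    fix w assume "w \<in> (\<lambda>w. \<lambda>u\<in>cube k. w (?\<tau> u)) -` {window k x c}"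
    then have "w (?\<tau> u) = x (c + u)" if "u \<in> cube k" for u
      using that by (auto simp: window_def fun_eq_iff restrict_def split: if_splits)
    then show "w \<in> Pi (cube n) C"
      by (auto simp: C_def)
  next
    fix w assume "w \<in> Pi (cube n) C"
    then have "w (?\<tau> u) = x (c + u)" if "u \<in> cube k" for u
      using that sub C_\<tau>[OF that] by blast
    then show "w \<in> (\<lambda>w. \<lambda>u\<in>cube k. w (?\<tau> u)) -` {window k x c}"
      by (auto simp: window_def)
  qed
  also have "measure_pmf.prob ?\<mu> (Pi (cube n) C) = (\<Prod>v\<in>cube n. measure_pmf.prob (p v) (C v))"
    by (rule measure_Pi_pmf_Pi) (rule finite_cube)
  also have "\<dots> = (\<Prod>v\<in>?\<tau> ` cube k. measure_pmf.prob (p v) (C v))"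
    using sub by (intro prod.mono_neutral_right) (auto simp: finite_cube C_UNIV)
  also have "\<dots> = (\<Prod>u\<in>cube k. measure_pmf.prob (p (?\<tau> u)) (C (?\<tau> u)))"
    using inj by (simp add: prod.reindex)
  also have "\<dots> = (\<Prod>u\<in>cube k. pmf (p (?\<tau> u)) (x (c + u)))"
    by (intro prod.cong) (auto simp: C_\<tau> measure_pmf_single)
  finally show ?thesis .
qed

text \<open>
  If each site may use only symbols of mass at least \<open>\<delta>\<close>, then each filling of a window has mass at
  least \<open>\<delta>\<close> to the power of the window's size. A single forbidden filling would therefore make the
  forbidden event at this window more likely than assumed.
\<close>

lemma admissible_at_large_atoms:
  fixes p :: "int ^ 'd::finite \<Rightarrow> 'a::finite pmf"
  assumes "k \<le> n" "n > 0" "0 < \<delta>"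
    and small: "measure_pmf.prob (marginal k n c (Pi_pmf (cube n) undefined p)) (- L) < \<delta> ^ (k ^ CARD('d))"
  shows "admissible_at k L (\<lambda>v. {a. \<delta> \<le> pmf (p (torus_mod n v)) a}) c"
  unfolding admissible_at_def
proof (intro allI impI, rule ccontr)
  let ?m = "marginal k n c (Pi_pmf (cube n) undefined p)"
  fix x assume x: "\<forall>v. x v \<in> {a. \<delta> \<le> pmf (p (torus_mod n v)) a}" and notin: "window k x c \<notin> L"
  have "\<delta> ^ (k ^ CARD('d)) = (\<Prod>u\<in>(cube k :: (int ^ 'd) set). \<delta>)"
    by (simp add: card_cube)
  also have "\<dots> \<le> (\<Prod>u\<in>cube k. pmf (p (torus_mod n (c + u))) (x (c + u)))"
    using x \<open>0 < \<delta>\<close> by (intro prod_mono) auto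
  also have "\<dots> = measure_pmf.prob ?m {window k x c}"
    using assms by (simp add: pmf_marginal_Pi_pmf measure_pmf_single)
  also have "\<dots> \<le> measure_pmf.prob ?m (- L)"
    using notin by (intro measure_pmf.finite_measure_mono) auto
  finally show False
    using small by simp
qed

lemma admissible_at_translate:
  "admissible_at k L (\<lambda>u. y (v + u)) c \<longleftrightarrow> admissible_at k L y (v + c)"
proof
  assume adm: "admissible_at k L (\<lambda>u. y (v + u)) c"
  show "admissible_at k L y (v + c)"
    unfolding admissible_at_def
  proof (intro allI impI)
    fix x assume "\<forall>u. x u \<in> y u"
    then have "window k (\<lambda>u. x (v + u)) c \<in> L"
      using adm by (auto simp: admissible_at_def)
    then show "window k x (v + c) \<in> L"
      by (simp add: window_def add.assoc)
  qed
next
  assume adm: "admissible_at k L y (v + c)"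
  show "admissible_at k L (\<lambda>u. y (v + u)) c"
    unfolding admissible_at_def
  proof (intro allI impI)
    fix x assume "\<forall>u. x u \<in> y (v + u)"
    then have "x (u - v) \<in> y u" for u
      by (metis add.commute diff_add_cancel)
    then have "window k (\<lambda>u. x (u - v)) (v + c) \<in> L"
      using adm by (auto simp: admissible_at_def)
    then show "window k x c \<in> L"
      by (simp add: window_def algebra_simps)
  qed
qed

section \<open>Counting fillings\<close>

lemma fillings_eq_PiE: "fillings T y = PiE T y"
  by (auto simp: fillings_def patterns_def)

lemma log_card_fillings:
  fixes y :: "int ^ 'd::finite \<Rightarrow> 'a::finite set"
  assumes "finite T" "\<And>v. v \<in> T \<Longrightarrow> y v \<noteq> {}"
  shows "log 2 (real (card (fillings T y))) = (\<Sum>v\<in>T. log 2 (real (card (y v))))"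
  using assms
  by (simp add: fillings_eq_PiE card_PiE log_def ln_prod flip: sum_divide_distrib)

lemma finite_set_blocks: "finite (set_blocks n X)"
proof (rule finite_subset)
  show "set_blocks n X \<subseteq> cube n \<rightarrow>\<^sub>E UNIV"
    by (auto simp: set_blocks_def)
qed (auto intro: finite_PiE simp: finite_cube)

lemma max_set_block:
  assumes "set_blocks n X \<noteq> {}"
  obtains w where "w \<in> set_blocks n X"
    "\<And>w'. w' \<in> set_blocks n X \<Longrightarrow>
       log 2 (real (card (fillings (cube n) w'))) \<le> log 2 (real (card (fillings (cube n) w)))"
proof -
  let ?f = "\<lambda>w. log 2 (real (card (fillings (cube n) w)))"
  have "Max (?f ` set_blocks n X) \<in> ?f ` set_blocks n X"
    using assms finite_set_blocks by (intro Max_in) auto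
  then obtain w where "w \<in> set_blocks n X" "?f w = Max (?f ` set_blocks n X)"
    by auto
  then show ?thesis
    using that[of w] finite_set_blocks[of n X] by (metis Max_ge finite_imageI imageI)
qed

section \<open>Neighbourhoods of a fully constrained system\<close>

text \<open>
  Every measure of the fully constrained system gives the complement of \<open>L\<close> mass 0, so that mass is
  itself a lower bound for the distance. If the system is empty, the infimum is \<open>\<infinity>\<close> and the
  neighbourhood is empty as well.
\<close>

lemma prob_le_of_tv_neighbourhood:
  assumes "\<mu> \<in> tv_neighbourhood k \<epsilon> (constrained_by k L)"
  shows "measure_pmf.prob \<mu> (- L) \<le> \<epsilon>"
proof -
  have "ereal (measure_pmf.prob \<mu> (- L)) \<le> (INF \<nu>\<in>constrained_by k L. ereal (tv_dist \<mu> \<nu>))"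
  proof (rule INF_greatest)
    fix \<nu> assume "\<nu> \<in> constrained_by k L"
    then have "measure_pmf.prob \<nu> (- L) = 0"
      using measure_pmf.prob_compl[of L \<nu>] by (simp add: constrained_by_def Compl_eq_Diff_UNIV)
    then have "measure_pmf.prob \<mu> (- L) = \<bar>measure_pmf.prob \<mu> (- L) - measure_pmf.prob \<nu> (- L)\<bar>"
      by simp
    also have "\<dots> \<le> tv_dist \<mu> \<nu>"
      unfolding tv_dist_def
    proof (rule cSUP_upper)
      have "\<bar>measure_pmf.prob \<mu> W - measure_pmf.prob \<nu> W\<bar> \<le> 1" for W
        using measure_pmf.prob_le_1[of \<mu> W] measure_pmf.prob_le_1[of \<nu> W]
          measure_nonneg[of \<mu> W] measure_nonneg[of \<nu> W] by linarith
      then show "bdd_above (range (\<lambda>W. \<bar>measure_pmf.prob \<mu> W - measure_pmf.prob \<nu> W\<bar>))"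
        by (intro bdd_aboveI[of _ 1]) auto
    qed simp
    finally show "ereal (measure_pmf.prob \<mu> (- L)) \<le> ereal (tv_dist \<mu> \<nu>)"
      by simp
  qed
  also have "\<dots> \<le> ereal \<epsilon>"
    using assms by (simp add: tv_neighbourhood_def)
  finally show ?thesis
    by simp
qed

text \<open>
  Redirecting all mass outside \<open>L\<close> to one fixed pattern of \<open>L\<close> gives a member of the system, at a
  distance of at most the mass that was moved. Together with the preceding lemma this describes the
  neighbourhood by a bound on the mass of the complement of \<open>L\<close>.
\<close>

lemma tv_neighbourhoodI:
  assumes "L \<subseteq> patterns (cube k)" "l \<in> L"
    and \<mu>: "\<mu> \<in> prob_measures (patterns (cube k))" and small: "measure_pmf.prob \<mu> (- L) \<le> \<epsilon>"
  shows "\<mu> \<in> tv_neighbourhood k \<epsilon> (constrained_by k L)"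
proof -
  define f where "f = (\<lambda>w. if w \<in> L then w else l)"
  define \<nu> where "\<nu> = map_pmf f \<mu>"
  have supp: "set_pmf \<nu> \<subseteq> L"
    using \<open>l \<in> L\<close> by (auto simp: \<nu>_def f_def)
  then have "measure_pmf.prob \<nu> L = 1"
    by (simp add: measure_pmf.prob_eq_1 AE_measure_pmf_iff subset_eq)
  with supp have \<nu>: "\<nu> \<in> constrained_by k L"
    using assms by (auto simp: constrained_by_def prob_measures_def)
  have "tv_dist \<mu> \<nu> \<le> measure_pmf.prob \<mu> (- L)"
    unfolding tv_dist_def
  proof (rule cSUP_least)
    fix W
    have le: "measure_pmf.prob \<mu> A \<le> measure_pmf.prob \<mu> C + measure_pmf.prob \<mu> (- L)"
      if "A \<subseteq> C \<union> - L" for A C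
    proof -
      have "measure_pmf.prob \<mu> A \<le> measure_pmf.prob \<mu> (C \<union> - L)"
        using that by (intro measure_pmf.finite_measure_mono) auto
      also have "\<dots> \<le> measure_pmf.prob \<mu> C + measure_pmf.prob \<mu> (- L)"
        by (intro measure_Un_le) auto
      finally show ?thesis .
    qed
    have "measure_pmf.prob \<nu> W = measure_pmf.prob \<mu> (f -` W)"
      by (simp add: \<nu>_def)
    moreover have "W \<subseteq> f -` W \<union> - L" "f -` W \<subseteq> W \<union> - L"
      by (auto simp: f_def)
    ultimately show "\<bar>measure_pmf.prob \<mu> W - measure_pmf.prob \<nu> W\<bar> \<le> measure_pmf.prob \<mu> (- L)"
      using le[of W "f -` W"] le[of "f -` W" W] by linarith
  qed simp
  with small have "ereal (tv_dist \<mu> \<nu>) \<le> ereal \<epsilon>"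
    by simp
  then have "(INF \<nu>\<in>constrained_by k L. ereal (tv_dist \<mu> \<nu>)) \<le> ereal \<epsilon>"
    using \<nu> by (rule INF_lower2[rotated])
  with \<mu> show ?thesis
    by (simp add: tv_neighbourhood_def)
qed

lemma avg_marginal_in_prob_measures:
  "avg_marginal k n \<mu> \<in> prob_measures (patterns (cube k))"
  by (auto simp: prob_measures_def avg_marginal_def marginal_def patterns_def)

section \<open>Upper bound: extracting a block from a product measure\<close>

text \<open>
  Markov's inequality for the mass of \<open>W\<close> seen through the windows of the torus.
\<close>

lemma card_bad_windows:
  fixes \<mu> :: "(int ^ 'd::finite \<Rightarrow> 'a::finite) pmf"
  assumes "n > 0"
  shows "real (card {v \<in> cube n. \<theta> \<le> measure_pmf.prob (marginal k n v \<mu>) W}) * \<theta>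
    \<le> real n ^ CARD('d) * measure_pmf.prob (avg_marginal k n \<mu>) W"
proof -
  let ?q = "\<lambda>v. measure_pmf.prob (marginal k n v \<mu>) W"
  have "real (card {v \<in> cube n. \<theta> \<le> ?q v}) * \<theta> = (\<Sum>v\<in>{v \<in> cube n. \<theta> \<le> ?q v}. \<theta>)"
    by simp
  also have "\<dots> \<le> (\<Sum>v\<in>{v \<in> cube n. \<theta> \<le> ?q v}. ?q v)"
    by (intro sum_mono) auto
  also have "\<dots> \<le> (\<Sum>v\<in>cube n. ?q v)"
    by (intro sum_mono2) (auto simp: finite_cube)
  also have "\<dots> = real n ^ CARD('d) * measure_pmf.prob (avg_marginal k n \<mu>) W"
    using assms by (simp add: prob_avg_marginal)
  finally show ?thesis .
qed

lemma card_translates_hitting: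
  fixes P :: "int ^ 'd::finite \<Rightarrow> bool"
  assumes "n > 0" "finite F" and periodic: "\<And>v. P (torus_mod n v) \<longleftrightarrow> P v"
  shows "card {v \<in> cube n. \<exists>c\<in>F. P (v + c)} \<le> card F * card {v \<in> cube n. P v}"
proof -
  have "card {v \<in> cube n. P (v + c)} = card {v \<in> cube n. P v}" for c
  proof -
    have "(\<Sum>v\<in>cube n. if P (v + c) then 1 else 0 :: nat) = (\<Sum>v\<in>cube n. if P v then 1 else 0)"
      using sum_torus_translate[of n "\<lambda>v. if P v then 1 else 0 :: nat" c] assms by simp
    then show ?thesis
      by (simp add: finite_cube flip: sum.inter_filter)
  qed
  moreover have "{v \<in> cube n. \<exists>c\<in>F. P (v + c)} = (\<Union>c\<in>F. {v \<in> cube n. P (v + c)})"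
    by auto
  ultimately show ?thesis
    using card_UN_le[OF \<open>finite F\<close>, of "\<lambda>c. {v \<in> cube n. P (v + c)}"] by simp
qed

text \<open>
  The core of the upper bound. Keep at each site only the symbols of mass at least \<open>\<delta>\<close>. The sites \<open>v\<close> of
  the torus at which all windows \<open>v + c\<close> with \<open>c \<in> F\<close> have small forbidden mass are good: by the hypothesis on \<open>F\<close>
  the block at \<open>v\<close> occurs in the set-valued shift, and its number of fillings controls the entropy of the
  sites in it. The other sites form a fraction of at most \<open>\<theta>\<close> of the torus, and there the entropy is only
  bounded by the size of the alphabet. Averaging over all translates of the block gives the entropy of
  the whole measure. Since \<open>\<theta> < 1\<close> there is a good site, so a block exists at all; this is how the case of
  an empty shift is covered.
\<close>

lemma entropy_le_block:
  fixes p :: "int ^ 'd::finite \<Rightarrow> 'a::finite pmf" and L :: "(int ^ 'd \<Rightarrow> 'a) set" and k :: nat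
  defines "X \<equiv> shift_avoiding k (patterns (cube k) - L)"
  assumes "finite F"
    and ext: "\<And>y. \<lbrakk>\<And>v. y v \<noteq> {}; \<And>c. c \<in> F \<Longrightarrow> admissible_at k L y c\<rbrakk>
      \<Longrightarrow> restrict y (cube r) \<in> set_blocks r (X)"
    and "k \<le> n" "n > 0" "r > 0" and \<delta>: "0 < \<delta>" "\<delta> * real CARD('a) \<le> 1"
    and \<epsilon>: "measure_pmf.prob (avg_marginal k n (Pi_pmf (cube n) undefined p)) (- L) \<le> \<epsilon>"
    and \<theta>: "real (card F) * \<epsilon> / \<delta> ^ (k ^ CARD('d)) \<le> \<theta>" "\<theta> < 1"
  shows "\<exists>w\<in>set_blocks r (X).
    shannon_entropy (Pi_pmf (cube n) undefined p) / real n ^ CARD('d) \<le>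
      log 2 (real (card (fillings (cube r) w))) / real r ^ CARD('d)
        + 3 * real CARD('a) * sqrt \<delta> / ln 2 + \<theta> * log 2 (real CARD('a))"
proof -
  let ?\<mu> = "Pi_pmf (cube n) undefined p"
  let ?B = "set_blocks r (X)"
  let ?f = "\<lambda>w. log 2 (real (card (fillings (cube r) w)))"
  let ?lN = "log 2 (real CARD('a))"
  define e where "e = 3 * real CARD('a) * sqrt \<delta> / ln 2"
  define H where "H v = shannon_entropy (p (torus_mod n v))" for v
  \<comment> \<open>The marginals are extended periodically to the lattice, so that blocks may wrap around the torus.\<close>
  define Y where "Y v = {a. \<delta> \<le> pmf (p (torus_mod n v)) a}" for v
  define \<eta> where "\<eta> = \<delta> ^ (k ^ CARD('d))"
  define bad where "bad v \<longleftrightarrow> \<eta> \<le> measure_pmf.prob (marginal k n v ?\<mu>) (- L)" for v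
  \<comment> \<open>The sites that are not good in the sense explained above.\<close>
  define G where "G = {v \<in> cube n. \<exists>c\<in>F. bad (v + c)}"
  have \<eta>: "\<eta> > 0"
    using \<delta> by (simp add: \<eta>_def)
  have nd: "real n ^ CARD('d) > 0" and rd: "real r ^ CARD('d) > 0"
    using assms by simp_all
  have lN: "?lN \<ge> 0"
    by (simp add: Suc_leI)
  have e: "e \<ge> 0"
    using \<delta> by (simp add: e_def)
  have Y: "Y v \<noteq> {}" "H v \<le> log 2 (real (card (Y v))) + e" for v
    using shannon_entropy_le_log_card_large[OF \<delta>, of "p (torus_mod n v)"]
    by (auto simp: Y_def H_def e_def)

  have "real (card {v \<in> cube n. bad v}) * \<eta> \<le> real n ^ CARD('d) * \<epsilon>"
    using card_bad_windows[OF \<open>n > 0\<close>, of \<eta> k ?\<mu> "- L"] mult_left_mono[OF \<epsilon>, of "real n ^ CARD('d)"]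
    by (simp add: bad_def)
  then have "real (card {v \<in> cube n. bad v}) \<le> real n ^ CARD('d) * \<epsilon> / \<eta>"
    using \<eta> by (simp add: field_simps)
  moreover have "real (card G) \<le> real (card F) * real (card {v \<in> cube n. bad v})"
    using card_translates_hitting[of n F bad] assms
    unfolding G_def by (simp add: bad_def marginal_torus_mod flip: of_nat_mult)
  ultimately have "real (card G) \<le> real (card F) * (real n ^ CARD('d) * \<epsilon> / \<eta>)"
    by (meson mult_left_mono of_nat_0_le_iff order_trans)
  also have "\<dots> = (real (card F) * \<epsilon> / \<eta>) * real n ^ CARD('d)"
    by simp
  also have "\<dots> \<le> \<theta> * real n ^ CARD('d)"
    using \<theta> by (intro mult_right_mono) (auto simp: \<eta>_def)
  finally have card_G: "real (card G) \<le> \<theta> * real n ^ CARD('d)" .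

  have good: "restrict (\<lambda>u. Y (v + u)) (cube r) \<in> ?B" if "v \<in> cube n" "v \<notin> G" for v
  proof (rule ext)
    fix c assume "c \<in> F"
    then have "measure_pmf.prob (marginal k n (v + c) ?\<mu>) (- L) < \<eta>"
      using that by (auto simp: G_def bad_def not_le)
    then have "admissible_at k L Y (v + c)"
      unfolding Y_def \<eta>_def using assms by (intro admissible_at_large_atoms)
    then show "admissible_at k L (\<lambda>u. Y (v + u)) c"
      by (simp add: admissible_at_translate)
  qed (rule Y)
  have "card G < card (cube n :: (int ^ 'd) set)"
  proof -
    have "real (card G) < real n ^ CARD('d)"
      using card_G mult_strict_right_mono[OF \<theta>(2) nd] by linarith
    then show ?thesis
      by (simp add: card_cube flip: of_nat_power)
  qed
  then have "\<not> cube n \<subseteq> G"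
    using card_mono[of G "cube n"] finite_cube[of n, where 'd = 'd] by (auto simp: G_def)
  then have "?B \<noteq> {}"
    using good by blast
  then obtain w where w: "w \<in> ?B" and max: "\<And>w'. w' \<in> ?B \<Longrightarrow> ?f w' \<le> ?f w"
    using max_set_block by metis
  have w0: "?f w \<ge> 0"
  proof -
    have "w u \<noteq> {}" if "u \<in> cube r" for u
      using w that by (auto simp: set_blocks_def set_shift_def set_patterns_def PiE_UNIV_domain Pi_def)
    then have "card (fillings (cube r) w) \<noteq> 0"
      by (simp add: fillings_eq_PiE card_PiE finite_cube)
    then show ?thesis
      by (simp add: Suc_leI)
  qed

  have inner: "(\<Sum>u\<in>cube r. H (v + u)) \<le>
      ?f w + real r ^ CARD('d) * e + (if v \<in> G then real r ^ CARD('d) * ?lN else 0)"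
    if "v \<in> cube n" for v
  proof (cases "v \<in> G")
    case True
    have "(\<Sum>u\<in>cube r. H (v + u)) \<le> (\<Sum>u\<in>(cube r :: (int ^ 'd) set). ?lN)"
      by (intro sum_mono) (simp add: H_def shannon_entropy_le_log_card)
    also have "\<dots> = real r ^ CARD('d) * ?lN"
      by (simp add: card_cube)
    finally show ?thesis
      using True w0 e rd by (simp add: add_increasing)
  next
    case False
    have "(\<Sum>u\<in>cube r. H (v + u)) \<le> (\<Sum>u\<in>cube r. log 2 (real (card (Y (v + u)))) + e)"
      by (intro sum_mono Y)
    also have "\<dots> = ?f (restrict (\<lambda>u. Y (v + u)) (cube r)) + real r ^ CARD('d) * e"
      by (simp add: sum.distrib card_cube log_card_fillings finite_cube Y)
    also have "\<dots> \<le> ?f w + real r ^ CARD('d) * e"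
      using max[OF good[OF that False]] by simp
    finally show ?thesis
      using False by simp
  qed
  have "real r ^ CARD('d) * shannon_entropy ?\<mu> =
      real (card (cube r :: (int ^ 'd) set)) * (\<Sum>v\<in>cube n. H v)"
    by (simp add: card_cube shannon_entropy_Pi_pmf finite_cube H_def torus_mod_cube)
  also have "\<dots> = (\<Sum>u\<in>cube r. \<Sum>v\<in>cube n. H (v + u))"
    using sum_torus_translate[of n H] \<open>n > 0\<close> by (simp add: H_def torus_mod_add_left[of n _ 0, simplified])
  also have "\<dots> = (\<Sum>v\<in>cube n. \<Sum>u\<in>cube r. H (v + u))"
    by (rule sum.swap)
  also have "\<dots> \<le> (\<Sum>v\<in>cube n. ?f w + real r ^ CARD('d) * e + (if v \<in> G then real r ^ CARD('d) * ?lN else 0))"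
    by (intro sum_mono inner)
  also have "\<dots> = real n ^ CARD('d) * (?f w + real r ^ CARD('d) * e) + real (card G) * (real r ^ CARD('d) * ?lN)"
  proof -
    have "cube n \<inter> G = G"
      by (auto simp: G_def)
    then show ?thesis
      by (simp add: sum.distrib sum.If_cases card_cube finite_cube algebra_simps)
  qed
  also have "\<dots> \<le> real n ^ CARD('d) * (?f w + real r ^ CARD('d) * e)
      + (\<theta> * real n ^ CARD('d)) * (real r ^ CARD('d) * ?lN)"
    using card_G lN rd by (intro add_left_mono mult_right_mono) auto
  finally have "shannon_entropy ?\<mu> / real n ^ CARD('d) \<le>
      ?f w / real r ^ CARD('d) + e + \<theta> * ?lN"
    using nd rd by (simp add: field_simps)
  with w show ?thesis
    unfolding e_def by blast
qed

text \<open>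
  The bound holds for every fixed block size \<open>r\<close>, not only in the limit. The parameters are chosen in the
  order \<open>r\<close>, \<open>F\<close>, \<open>\<delta>\<close>, \<open>\<epsilon>\<close>: for given \<open>k\<close> and \<open>L\<close> the region \<open>F\<close> depends on \<open>r\<close> only, and \<open>\<epsilon>\<close> must be
  small compared with \<open>\<delta>\<close> to the power of the window's size.
\<close>

lemma h_ind_le_block_rate:
  fixes L :: "(int ^ 'd::finite \<Rightarrow> 'a::finite) set"
  assumes "r > 0"
  shows "h_ind k (constrained_by k L) \<le> ereal (1 / real r ^ CARD('d)) *
    (SUP w\<in>set_blocks r (shift_avoiding k (patterns (cube k) - L)).
       ereal (log 2 (real (card (fillings (cube r) w)))))"
    (is "_ \<le> ?a * (SUP w\<in>?B. ereal (?f w))")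
proof (rule locally_admissible_imp_extendable[of k L r])
  fix F :: "(int ^ 'd) set"
  assume F: "finite F" and
    ext: "\<And>y. \<lbrakk>\<And>v. y v \<noteq> {}; \<And>c. c \<in> F \<Longrightarrow> admissible_at k L y c\<rbrakk> \<Longrightarrow> restrict y (cube r) \<in> ?B"
  show "h_ind k (constrained_by k L) \<le> ?a * (SUP w\<in>?B. ereal (?f w))"
  proof (rule ereal_le_epsilon2)
    fix e :: real assume "e > 0"
    let ?N = "real CARD('a)"
    let ?lN = "log 2 ?N"
    have "((\<lambda>\<delta>. 3 * ?N * sqrt \<delta> / ln 2) \<longlongrightarrow> 0) (at_right 0)"
      "((\<lambda>\<delta>. \<delta> * ?N) \<longlongrightarrow> 0) (at_right 0)"
      by (auto intro!: tendsto_eq_intros)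
    then have "\<forall>\<^sub>F \<delta> in at_right 0. 3 * ?N * sqrt \<delta> / ln 2 < e / 2 \<and> \<delta> * ?N < 1 \<and> 0 < \<delta>"
      using \<open>e > 0\<close> by (intro eventually_conj order_tendstoD eventually_at_right_less) auto
    then obtain \<delta> where \<delta>: "3 * ?N * sqrt \<delta> / ln 2 < e / 2" "\<delta> * ?N < 1" "0 < \<delta>"
      using eventually_happens by fastforce
    define \<theta> where "\<theta> \<epsilon> = real (card F) * \<epsilon> / \<delta> ^ (k ^ CARD('d))" for \<epsilon>
    have "((\<lambda>\<epsilon>. \<theta> \<epsilon>) \<longlongrightarrow> 0) (at_right 0)" "((\<lambda>\<epsilon>. \<theta> \<epsilon> * ?lN) \<longlongrightarrow> 0) (at_right 0)"
      unfolding \<theta>_def using \<delta> by (auto intro!: tendsto_eq_intros)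
    then have "\<forall>\<^sub>F \<epsilon> in at_right 0. \<theta> \<epsilon> < 1 \<and> \<theta> \<epsilon> * ?lN < e / 2"
      using \<open>e > 0\<close> by (intro eventually_conj order_tendstoD) auto
    then have "\<forall>\<^sub>F \<epsilon> in at_right 0. h_ind_hat k (tv_neighbourhood k \<epsilon> (constrained_by k L))
        \<le> ?a * (SUP w\<in>?B. ereal (?f w)) + ereal e"
    proof eventually_elim
      case (elim \<epsilon>)
      let ?\<Gamma> = "tv_neighbourhood k \<epsilon> (constrained_by k L)"
      have "(SUP \<mu>\<in>product_measures k n ?\<Gamma>. ereal (shannon_entropy \<mu> / real n ^ CARD('d)))
          \<le> ?a * (SUP w\<in>?B. ereal (?f w)) + ereal e" if n: "max k 1 \<le> n" for n
      proof (rule SUP_least)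
        fix \<mu> assume "\<mu> \<in> product_measures k n ?\<Gamma>"
        then obtain p where \<mu>: "\<mu> = Pi_pmf (cube n) undefined p" and "avg_marginal k n \<mu> \<in> ?\<Gamma>"
          by (auto simp: product_measures_def)
        then have "measure_pmf.prob (avg_marginal k n (Pi_pmf (cube n) undefined p)) (- L) \<le> \<epsilon>"
          by (simp add: prob_le_of_tv_neighbourhood)
        then obtain w where w: "w \<in> ?B" and
          le: "shannon_entropy \<mu> / real n ^ CARD('d) \<le>
            ?f w / real r ^ CARD('d) + 3 * ?N * sqrt \<delta> / ln 2 + \<theta> \<epsilon> * ?lN"
          using entropy_le_block[OF F ext, of n \<delta> p \<epsilon> "\<theta> \<epsilon>"] n \<delta> elim \<open>r > 0\<close>
          by (auto simp: \<theta>_def \<mu>)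
        then have "ereal (shannon_entropy \<mu> / real n ^ CARD('d)) \<le> ?a * ereal (?f w) + ereal e"
          using \<delta>(1) elim by simp
        also have "\<dots> \<le> ?a * (SUP w\<in>?B. ereal (?f w)) + ereal e"
          using w by (intro add_right_mono ereal_mult_left_mono SUP_upper) auto
        finally show "ereal (shannon_entropy \<mu> / real n ^ CARD('d)) \<le> \<dots>" .
      qed
      then show ?case
        unfolding h_ind_hat_def
        by (intro Limsup_bounded eventually_sequentiallyI[of "max k 1"])
    qed
    then show "h_ind k (constrained_by k L) \<le> ?a * (SUP w\<in>?B. ereal (?f w)) + ereal e"
      by (intro tendsto_upperbound[OF tendsto_h_ind]) auto
  qed
qed

section \<open>Lower bound: uniform measures on fillings\<close>

text \<open>
  A filling of a single window extends to a filling of the lattice.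
\<close>

lemma set_shift_window_in:
  assumes y: "y \<in> set_shift (shift_avoiding k (patterns (cube k) - L))"
    and w: "\<And>u. u \<in> cube k \<Longrightarrow> w u \<in> y (c + u)"
  shows "restrict w (cube k) \<in> L"
proof -
  define x where "x v = (if v - c \<in> cube k then w (v - c) else SOME a. a \<in> y v)" for v
  have ne: "y v \<noteq> {}" for v
    using y by (simp add: set_shift_avoiding_iff)
  have "x v \<in> y v" for v
    using w[of "v - c"] ne[of v] by (auto simp: x_def some_in_eq)
  then have "window k x c \<in> L"
    using y by (auto simp: set_shift_avoiding_iff admissible_at_def)
  also have "window k x c = restrict w (cube k)"
    unfolding window_def by (rule restrict_ext) (simp add: x_def)
  finally show ?thesis .
qed

text \<open>
  Windows that lie inside the cube show fillings of an element of the set-valued shift, hence patterns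
  of \<open>L\<close>. Only the windows that wrap around the torus can show other patterns, and these become
  negligible as \<open>n\<close> grows.
\<close>

lemma prob_avg_marginal_uniform:
  fixes y :: "int ^ 'd::finite \<Rightarrow> 'a::finite set"
  assumes y: "y \<in> set_shift (shift_avoiding k (patterns (cube k) - L))"
    and n: "k \<le> n" "n > 0"
  shows "measure_pmf.prob (avg_marginal k n (Pi_pmf (cube n) undefined (\<lambda>v. pmf_of_set (y v)))) (- L)
    \<le> 1 - (real (n - k) / real n) ^ CARD('d)"
proof -
  let ?\<mu> = "Pi_pmf (cube n) undefined (\<lambda>v. pmf_of_set (y v))"
  let ?q = "\<lambda>v. measure_pmf.prob (marginal k n v ?\<mu>) (- L)"
  have zero: "?q c = 0" if c: "c \<in> cube (n - k)" for c
  proof -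
    have "c + u \<in> cube n" if "u \<in> cube k" for u
    proof -
      have "0 \<le> c $ i \<and> c $ i < int (n - k)" "0 \<le> u $ i \<and> u $ i < int k" for i
        using c that by (auto simp: cube_def)
      then show ?thesis
        using n by (auto simp: cube_def of_nat_diff) (smt (verit))
    qed
    then have "set_pmf (marginal k n c ?\<mu>) \<subseteq> L"
      using y set_shift_window_in[OF y]
      by (auto simp: marginal_alt set_Pi_pmf finite_cube PiE_dflt_def torus_mod_cube
          set_shift_avoiding_iff intro!: set_shift_window_in[OF y, of _ c])
    then show ?thesis
      by (auto simp: measure_pmf_zero_iff)
  qed
  have sub: "cube (n - k) \<subseteq> (cube n :: (int ^ 'd) set)"
    using n by (auto simp: cube_def of_nat_diff intro: less_le_trans)
  have "(\<Sum>v\<in>cube n. ?q v) = (\<Sum>v\<in>cube n - cube (n - k). ?q v)"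
    by (intro sum.mono_neutral_right finite_cube ballI zero) auto
  also have "\<dots> \<le> (\<Sum>v\<in>(cube n - cube (n - k) :: (int ^ 'd) set). 1)"
    by (intro sum_mono) simp
  also have "\<dots> = real n ^ CARD('d) - real (n - k) ^ CARD('d)"
    using card_Diff_subset[OF finite_cube sub] power_mono[of "n - k" n "CARD('d)"]
    by (simp add: card_cube of_nat_diff)
  finally have "(\<Sum>v\<in>cube n. ?q v) / real n ^ CARD('d) \<le>
      (real n ^ CARD('d) - real (n - k) ^ CARD('d)) / real n ^ CARD('d)"
    by (intro divide_right_mono) auto
  also have "\<dots> = 1 - (real (n - k) / real n) ^ CARD('d)"
    using n by (simp add: diff_divide_distrib power_divide del: of_nat_diff)
  finally show ?thesis
    using n by (simp add: prob_avg_marginal)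
qed

text \<open>
  A block with the most fillings, with the uniform measure on them, competes in the supremum that defines
  the independence entropy as soon as the wrapping windows are a fraction of at most \<open>\<epsilon>\<close>.
\<close>

lemma h_ind_com_shift_le_h_ind_hat:
  fixes L :: "(int ^ 'd::finite \<Rightarrow> 'a::finite) set"
  assumes L: "L \<subseteq> patterns (cube k)" and "\<epsilon> > 0"
  shows "h_ind_com_shift (shift_avoiding k (patterns (cube k) - L))
    \<le> h_ind_hat k (tv_neighbourhood k \<epsilon> (constrained_by k L))"
  unfolding h_ind_com_shift_def h_ind_hat_def
proof (rule Limsup_mono)
  let ?X = "shift_avoiding k (patterns (cube k) - L)"
  let ?\<Gamma> = "tv_neighbourhood k \<epsilon> (constrained_by k L)"
  have "(\<lambda>n. real (n - k) / real n) \<longlonglongrightarrow> 1"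
    by real_asymp
  then have "(\<lambda>n. 1 - (real (n - k) / real n) ^ CARD('d)) \<longlonglongrightarrow> 1 - 1 ^ CARD('d)"
    by (intro tendsto_intros)
  then have "\<forall>\<^sub>F n in sequentially. 1 - (real (n - k) / real n) ^ CARD('d) < \<epsilon>"
    using \<open>\<epsilon> > 0\<close> by (intro order_tendstoD) auto
  then show "\<forall>\<^sub>F n in sequentially.
      ereal (1 / real n ^ CARD('d)) * (SUP w\<in>set_blocks n ?X. ereal (log 2 (real (card (fillings (cube n) w)))))
      \<le> (SUP \<mu>\<in>product_measures k n ?\<Gamma>. ereal (shannon_entropy \<mu> / real n ^ CARD('d)))"
    using eventually_ge_at_top[of k] eventually_gt_at_top[of 0]
  proof eventually_elim
    case (elim n)
    show ?case
    proof (cases "set_blocks n ?X = {}")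
      case True
      then show ?thesis
        using elim by (simp add: bot_ereal_def)
    next
      case False
      then obtain w where w: "w \<in> set_blocks n ?X" and
        max: "\<And>w'. w' \<in> set_blocks n ?X \<Longrightarrow>
          log 2 (real (card (fillings (cube n) w'))) \<le> log 2 (real (card (fillings (cube n) w)))"
        using max_set_block by metis
      then obtain y where y: "y \<in> set_shift ?X" and w_eq: "w = restrict y (cube n)"
        by (auto simp: set_blocks_def)
      have ne: "y v \<noteq> {}" for v
        using y by (simp add: set_shift_avoiding_iff)
      define \<mu> where "\<mu> = Pi_pmf (cube n) undefined (\<lambda>v. pmf_of_set (y v))"
      have "shannon_entropy \<mu> = log 2 (real (card (fillings (cube n) w)))"
        using ne by (simp add: \<mu>_def shannon_entropy_Pi_pmf finite_cube w_eq log_card_fillings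
            shannon_entropy_pmf_of_set)
      moreover have "\<mu> \<in> product_measures k n ?\<Gamma>"
      proof -
        obtain l where "l \<in> L"
          using set_shift_window_in[OF y, of "\<lambda>u. SOME a. a \<in> y u" 0] ne by (auto simp: some_in_eq)
        then have "avg_marginal k n \<mu> \<in> ?\<Gamma>"
          using prob_avg_marginal_uniform[OF y, of n] elim
          by (intro tv_neighbourhoodI[OF L] avg_marginal_in_prob_measures) (auto simp: \<mu>_def)
        then show ?thesis
          by (auto simp: product_measures_def \<mu>_def)
      qed
      ultimately have "ereal (log 2 (real (card (fillings (cube n) w))) / real n ^ CARD('d))
          \<le> (SUP \<mu>\<in>product_measures k n ?\<Gamma>. ereal (shannon_entropy \<mu> / real n ^ CARD('d)))"
        by (metis (no_types, lifting) SUP_upper)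
      moreover have "(SUP w\<in>set_blocks n ?X. ereal (log 2 (real (card (fillings (cube n) w)))))
          \<le> ereal (log 2 (real (card (fillings (cube n) w))))"
        using max by (intro SUP_least) simp
      then have "ereal (1 / real n ^ CARD('d)) * (SUP w\<in>set_blocks n ?X. ereal (log 2 (real (card (fillings (cube n) w)))))
          \<le> ereal (1 / real n ^ CARD('d)) * ereal (log 2 (real (card (fillings (cube n) w))))"
        by (intro ereal_mult_left_mono) auto
      ultimately show ?thesis
        by simp
    qed
  qed
qed

section \<open>Equality of the two entropies\<close>

theorem theorem22:
  fixes \<Gamma> :: "(int ^ 'd::finite \<Rightarrow> 'a::finite) pmf set" and k :: nat
  assumes "k \<ge> 1" and "fully_constrained k \<Gamma>"
  shows "h_ind k \<Gamma> = h_ind_com k \<Gamma>"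
proof -
  obtain L where L: "L \<subseteq> patterns (cube k)" and \<Gamma>: "\<Gamma> = constrained_by k L"
    using assms by (auto simp: fully_constrained_def)
  have com: "h_ind_com k \<Gamma> = h_ind_com_shift (shift_avoiding k (patterns (cube k) - L))"
    using L by (simp add: h_ind_com_def forbidden_patterns_def \<Gamma> allowed_patterns_constrained_by)
  show ?thesis
  proof (rule antisym)
    show "h_ind k \<Gamma> \<le> h_ind_com k \<Gamma>"
      unfolding com unfolding h_ind_com_shift_def \<Gamma>
      by (intro le_Limsup eventually_sequentiallyI[of 1] h_ind_le_block_rate) auto
    have "\<forall>\<^sub>F \<epsilon> in at_right 0. h_ind_com k \<Gamma> \<le> h_ind_hat k (tv_neighbourhood k \<epsilon> \<Gamma>)"
      using eventually_at_right_less[of 0]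
      by eventually_elim (unfold com, simp add: \<Gamma> h_ind_com_shift_le_h_ind_hat L)
    then show "h_ind_com k \<Gamma> \<le> h_ind k \<Gamma>"
      by (intro tendsto_lowerbound[OF tendsto_h_ind]) auto
  qed
qed

end
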